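(* (a) (mod-BPDN) Let $L(b)=\gamma\|b_{T^c}\|_1+\tfrac12\|y-Ab\|_2^2$. Suppose $A_{T\cup\Delta}'A_{T\cup\Delta}$ is invertible, $ERC_{T}(\Delta)>0$ and $$\gamma\ge\frac{\|{A_{(T\cup\Delta)^c}}'(y-A\,c_{T}(\Delta))\|_\infty}{ERC_{T}(\Delta)} .$$ Then $L$ has a unique minimizer $\hat x$ over $\mathbb{R}^m$; $\hat x=d_{T}(\Delta)$, and thus $\hat x$ is supported on $T\cup\Delta$; and $$\|x-\hat x\|_2\le\gamma\sqrt{|\Delta|}\sqrt{\|({A_T}'A_T)^{-1}{A_T}'A_\Delta P_{T}(\Delta)\|_2^2+\|P_{T}(\Delta)\|_2^2}+\|({A_{T\cup\Delta}}'A_{T\cup\Delta})^{-1}{A_{T\cup\Delta}}'\|_2\,\|w\|_2 .$$ (b) (BPDN) The same holds with $T=\emptyset$, $\Delta=N$: let $L(b)=\gamma\|b\|_1+\tfrac12\|y-Ab\|_2^2$. Suppose ${A_N}'A_N$ is invertible, $ERC_{\emptyset}(N)=1-\max_{\omega\notin N}\|({A_N}'A_N)^{-1}{A_N}'A_\omega\|_1>0$ and $\gamma\ge\|{A_{N^c}}'(y-A\,c_{\emptyset}(N))\|_\infty/ERC_{\emptyset}(N)$. Then $L$ has a unique minimizer $\hat x$ over $\mathbb{R}^m$; $\hat x=d_{\emptyset}(N)$, and thus $\hat x$ is supported on $N$; and $$\|x-\hat x\|_2\le\gamma\sqrt{|N|}\,\|({A_N}'A_N)^{-1}\|_2+\|({A_N}'A_N)^{-1}{A_N}'\|_2\,\|w\|_2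 .$$
   Context: Let $n<m$ be positive integers, $A\in\mathbb{R}^{n\times m}$, $x\in\mathbb{R}^m$ with support $N=\{i:x_i\ne0\}$, $w\in\mathbb{R}^n$ and $y=Ax+w$. Let $T\subseteq\{1,\dots,m\}$ and $\Delta=N\setminus T$. Let $\gamma>0$ be real. Notation: $'$ is transpose; $b_S$ is the subvector of $b$ indexed by $S$; $A_S$ is the submatrix of columns of $A$ indexed by $S$, $A_\omega$ a single column; $S^c$ is the complement in $\{1,\dots,m\}$; $\|\cdot\|_2$ of a matrix is the spectral (operator) norm. A vector is "supported on" a set if its nonzero entries all have indices in that set. Maxima over empty sets and norms of empty vectors or matrices are $0$; an empty matrix counts as invertible. Define $$M_{T}=I-A_T({A_T}'A_T)^{-1}{A_T}',\quad P_{T}(\Delta)=({A_\Delta}'M_{T}A_\Delta)^{-1},\quad ERC_{T}(\Delta)=1-\max_{\omega\notin T\cup\Delta}\|P_{T}(\Delta){A_\Delta}'M_{T}A_\omega\|_1$$ (for $T=\emptyset$, $M_\emptyset=I$). The inverses exist when ${A_{T\cup\Delta}}'A_{T\cup\Delta}$ is invertible. In that case $d_{T}(\Delta)$ and $c_{T}(\Delta)$ denote the unique minimizers, over vectors $b\in\mathbb{R}^m$ with $b_{(T\cup\Delta)^c}=0$, of $\gamma\|b_{T^c}\|_1+\tfrac12\|y-Ab\|_2^2$ and of $\tfrac12\|y-Ab\|_2^2$, respectively. *)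

theory Defs
  imports "HOL-Analysis.Analysis"
begin

text \<open>
  A vector or matrix indexed by a subset of the index type is represented by its extension by zero
  to the full index type. So for \<open>A :: real^'m^'n\<close> the submatrix of the columns in \<open>S\<close> keeps the
  type of \<open>A\<close>, with all columns outside \<open>S\<close> set to zero. Products, transposes, the norms used below
  and the condition of being zero are unaffected by this padding, and empty vectors and matrices
  become zero, hence have norm \<open>0\<close>.
\<close>

definition subvec :: "real^'m \<Rightarrow> 'm set \<Rightarrow> real^'m" where
  "subvec b S = (\<chi> i. if i \<in> S then b $ i else 0)"

definition subcols :: "real^'m^'n \<Rightarrow> 'm set \<Rightarrow> real^'m^'n" where
  "subcols A S = (\<chi> i j. if j \<in> S then A $ i $ j else 0)"

definition id_on :: "'m set \<Rightarrow> real^'m^'m" where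
  "id_on S = (\<chi> i j. if i = j \<and> i \<in> S then 1 else 0)"

text \<open>
  Inverses of \<open>S \<times> S\<close> matrices. Only used for matrices \<open>G\<close> that vanish outside \<open>S \<times> S\<close>;
  the first conjunct says that \<open>H\<close> vanishes there as well.
\<close>

definition inverse_on :: "'m set \<Rightarrow> real^'m^'m \<Rightarrow> real^'m^'m \<Rightarrow> bool" where
  "inverse_on S G H \<longleftrightarrow>
     (\<forall>i j. i \<notin> S \<or> j \<notin> S \<longrightarrow> H $ i $ j = 0) \<and> G ** H = id_on S \<and> H ** G = id_on S"

definition invertible_on :: "'m::finite set \<Rightarrow> real^'m^'m \<Rightarrow> bool" where
  "invertible_on S G \<longleftrightarrow> (\<exists>H. inverse_on S G H)"

definition inv_on :: "'m::finite set \<Rightarrow> real^'m^'m \<Rightarrow> real^'m^'m" where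
  "inv_on S G = (THE H. inverse_on S G H)"

lemma id_on_mult:
  assumes "\<forall>i j. i \<notin> S \<or> j \<notin> S \<longrightarrow> H $ i $ j = 0"
  shows "id_on S ** H = H" "H ** id_on S = H"
proof -
  have "(\<Sum>k\<in>UNIV. id_on S $ i $ k * H $ k $ j) = H $ i $ j" for i j
  proof -
    have "(\<Sum>k\<in>UNIV. id_on S $ i $ k * H $ k $ j) = (\<Sum>k\<in>UNIV. if i = k then H $ k $ j else 0)"
      using assms by (intro sum.cong) (auto simp: id_on_def)
    then show ?thesis by simp
  qed
  then show "id_on S ** H = H" by (simp add: matrix_matrix_mult_def vec_eq_iff)
  have "(\<Sum>k\<in>UNIV. H $ i $ k * id_on S $ k $ j) = H $ i $ j" for i j
  proof -
    have "(\<Sum>k\<in>UNIV. H $ i $ k * id_on S $ k $ j) = (\<Sum>k\<in>UNIV. if k = j then H $ i $ k else 0)"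
      using assms by (intro sum.cong) (auto simp: id_on_def)
    then show ?thesis by simp
  qed
  then show "H ** id_on S = H" by (simp add: matrix_matrix_mult_def vec_eq_iff)
qed

lemma inverse_on_unique:
  assumes "inverse_on S G H" "inverse_on S G K"
  shows "H = K"
proof -
  have "H = H ** (G ** K)" using assms id_on_mult(2)[of S H] by (simp add: inverse_on_def)
  also have "\<dots> = (H ** G) ** K" by (simp add: matrix_mul_assoc)
  also have "\<dots> = K" using assms id_on_mult(1)[of S K] by (simp add: inverse_on_def)
  finally show ?thesis .
qed

lemma inv_on_eqI: "inverse_on S G H \<Longrightarrow> inv_on S G = H"
  unfolding inv_on_def using inverse_on_unique by blast

lemma invertible_on_UNIV:
  fixes G :: "real^'m^'m"
  shows "invertible_on UNIV G \<longleftrightarrow> invertible G"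
proof -
  have "id_on UNIV = (mat 1 :: real^'m^'m)" by (simp add: id_on_def mat_def)
  then show ?thesis by (simp add: invertible_on_def inverse_on_def invertible_def)
qed

lemma invertible_on_empty: "invertible_on {} 0"
  unfolding invertible_on_def inverse_on_def id_on_def
  by (rule exI[of _ 0]) (simp add: vec_eq_iff matrix_matrix_mult_def)

definition norm_1 :: "real^'m \<Rightarrow> real" where
  "norm_1 v = (\<Sum>i\<in>UNIV. \<bar>v $ i\<bar>)"

definition spectral_norm :: "real^'m^'k \<Rightarrow> real" where
  "spectral_norm B = onorm (\<lambda>v. B *v v)"

definition gram :: "real^'m^'n \<Rightarrow> 'm set \<Rightarrow> real^'m^'m" where
  "gram A S = transpose (subcols A S) ** subcols A S"

definition M_proj :: "real^'m^'n \<Rightarrow> 'm set \<Rightarrow> real^'n^'n" where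
  "M_proj A T = mat 1 - subcols A T ** inv_on T (gram A T) ** transpose (subcols A T)"

definition P_mat :: "real^'m^'n \<Rightarrow> 'm set \<Rightarrow> 'm set \<Rightarrow> real^'m^'m" where
  "P_mat A T D = inv_on D (transpose (subcols A D) ** M_proj A T ** subcols A D)"

text \<open>
  Maximum of a finite set of nonnegative reals, with value \<open>0\<close> for the empty set.
\<close>

definition max0 :: "real set \<Rightarrow> real" where
  "max0 X = (if X = {} then 0 else Max X)"

definition ERC :: "real^'m^'n \<Rightarrow> 'm set \<Rightarrow> 'm set \<Rightarrow> real" where
  "ERC A T D = 1 - max0 ((\<lambda>\<omega>. norm_1 ((P_mat A T D ** transpose (subcols A D) ** M_proj A T)
                                    *v column \<omega> A)) ` (- (T \<union> D)))"

definition supported_on :: "real^'m \<Rightarrow> 'm set \<Rightarrow> bool" where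
  "supported_on b S \<longleftrightarrow> {i. b $ i \<noteq> 0} \<subseteq> S"

definition sq_loss :: "real^'m^'n \<Rightarrow> real^'n \<Rightarrow> real^'m \<Rightarrow> real" where
  "sq_loss A y b = 1/2 * (norm (y - A *v b))\<^sup>2"

definition mod_bpdn_obj :: "real^'m^'n \<Rightarrow> real^'n \<Rightarrow> real \<Rightarrow> 'm set \<Rightarrow> real^'m \<Rightarrow> real" where
  "mod_bpdn_obj A y \<gamma> T b = \<gamma> * norm_1 (subvec b (- T)) + sq_loss A y b"

definition bpdn_obj :: "real^'m^'n \<Rightarrow> real^'n \<Rightarrow> real \<Rightarrow> real^'m \<Rightarrow> real" where
  "bpdn_obj A y \<gamma> b = \<gamma> * norm_1 b + sq_loss A y b"

definition d_min :: "real^'m^'n \<Rightarrow> real^'n \<Rightarrow> real \<Rightarrow> 'm set \<Rightarrow> 'm set \<Rightarrow> real^'m" where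
  "d_min A y \<gamma> T D = (THE b. is_arg_min (mod_bpdn_obj A y \<gamma> T)
                              (\<lambda>b. subvec b (- (T \<union> D)) = 0) b)"

definition c_min :: "real^'m^'n \<Rightarrow> real^'n \<Rightarrow> 'm set \<Rightarrow> 'm set \<Rightarrow> real^'m" where
  "c_min A y T D = (THE b. is_arg_min (sq_loss A y) (\<lambda>b. subvec b (- (T \<union> D)) = 0) b)"

end

theory Submission
  imports Defs
begin

text \<open>
  Write \<open>S = T \<union> \<Delta>\<close>. A vector with a nonzero entry outside \<open>S\<close> is strictly beaten by one supported
  on \<open>S\<close>, obtained by refitting its outer part with the columns in \<open>S\<close>; so the unique minimizer
  \<open>d\<close> over vectors supported on \<open>S\<close> is the unique global one. For the error, \<open>c - x\<close> is the least
  squares solution for \<open>w\<close>, and \<open>c - d\<close> is the preimage under the Gram matrix of \<open>S\<close> of the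
  correlations \<open>f\<close> of the columns with \<open>y - A d\<close>. Varying one coordinate of \<open>d\<close> at a time shows
  that \<open>f\<close> vanishes on \<open>T\<close> and is bounded by \<open>\<gamma>\<close> on \<open>\<Delta>\<close>, and block elimination yields
  the two blocks in the bound.
\<close>

declare transpose_matrix_vector [simp del]

section \<open>Zero-padded vectors and matrices, and the norms on them\<close>

lemma subvec_nth: "subvec b S $ i = (if i \<in> S then b $ i else 0)"
  by (simp add: subvec_def)

lemma subvec_subvec: "subvec (subvec b S) R = subvec b (S \<inter> R)"
  by (simp add: vec_eq_iff subvec_nth)

lemma subvec_zero: "subvec 0 S = 0"
  by (simp add: vec_eq_iff subvec_nth)

lemma subvec_add: "subvec (a + b) S = subvec a S + subvec b S"
  by (simp add: vec_eq_iff subvec_nth)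

lemma subvec_diff: "subvec (a - b) S = subvec a S - subvec b S"
  by (simp add: vec_eq_iff subvec_nth)

lemma subvec_scaleR: "subvec (t *\<^sub>R b) S = t *\<^sub>R subvec b S"
  by (simp add: vec_eq_iff subvec_nth)

lemma subvec_Compl: "subvec b S + subvec b (- S) = b"
  by (simp add: vec_eq_iff subvec_nth)

text \<open>The fixed-point equation \<open>subvec b S = b\<close> is the working form of "supported
  on \<open>S\<close>" throughout, because it can be used directly as a rewrite rule. This and the
  next lemmas connect it with the other forms.\<close>

lemma subvec_Compl_eq_0_iff: "subvec b (- S) = 0 \<longleftrightarrow> subvec b S = b"
  by (auto simp: vec_eq_iff subvec_nth)

lemma subvec_eq_self_iff: "subvec b S = b \<longleftrightarrow> (\<forall>i. i \<notin> S \<longrightarrow> b $ i = 0)"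
  unfolding vec_eq_iff subvec_nth by (metis (full_types))

lemma subvec_mono:
  assumes "subvec b S = b" "S \<subseteq> R"
  shows "subvec b R = b"
  using assms by (auto simp: subvec_eq_self_iff)

lemma supported_on_iff_subvec: "supported_on b S \<longleftrightarrow> subvec b S = b"
  by (auto simp: supported_on_def subvec_eq_self_iff)

lemma inner_subvec: "inner (subvec a S) b = inner a (subvec b S)"
  by (auto simp: inner_vec_def subvec_nth intro!: sum.cong)

lemma norm_subvec_Un_sq:
  assumes "S \<inter> R = {}"
  shows "(norm (subvec b (S \<union> R)))\<^sup>2 = (norm (subvec b S))\<^sup>2 + (norm (subvec b R))\<^sup>2"
proof -
  have "subvec b (S \<union> R) = subvec b S + subvec b R"
    using assms by (auto simp: vec_eq_iff subvec_nth)
  moreover have "inner (subvec b S) (subvec b R) = 0"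
    using assms by (simp add: inner_subvec subvec_subvec Int_commute)
      (simp add: subvec_def flip: zero_vec_def)
  ultimately show ?thesis
    by (simp add: power2_norm_eq_inner inner_add inner_commute)
qed

lemma norm_le_sqrt_card:
  fixes b :: "real^'m"
  assumes "subvec b S = b" and "\<And>i. i \<in> S \<Longrightarrow> \<bar>b $ i\<bar> \<le> \<gamma>" and "\<gamma> \<ge> 0"
  shows "norm b \<le> \<gamma> * sqrt (card S)"
proof -
  have "(norm b)\<^sup>2 = (\<Sum>i\<in>UNIV. (b $ i)\<^sup>2)"
    by (simp add: norm_vec_def L2_set_def sum_nonneg)
  also have "\<dots> = (\<Sum>i\<in>S. (b $ i)\<^sup>2)"
    using assms(1) by (intro sum.mono_neutral_right) (auto simp: subvec_eq_self_iff)
  also have "\<dots> \<le> (\<Sum>i\<in>S. \<gamma>\<^sup>2)"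
    using assms(2,3) by (intro sum_mono) (simp add: abs_le_square_iff[symmetric])
  also have "\<dots> = (\<gamma> * sqrt (card S))\<^sup>2"
    by (simp add: power_mult_distrib)
  finally show ?thesis
    using assms(3) by (simp add: power2_le_iff_abs_le abs_le_square_iff[symmetric])
qed

lemma norm_diff_power2:
  fixes a b :: "'a :: real_inner"
  shows "(norm (a - b))\<^sup>2 = (norm a)\<^sup>2 - 2 * inner a b + (norm b)\<^sup>2"
  by (simp add: power2_norm_eq_inner inner_diff inner_commute)

lemma norm_1_nonneg: "norm_1 v \<ge> 0"
  by (simp add: norm_1_def sum_nonneg)

lemma norm_1_pos: "v \<noteq> 0 \<Longrightarrow> norm_1 v > 0"
  unfolding norm_1_def by (auto simp: vec_eq_iff intro: sum_pos2)

lemma norm_1_zero: "norm_1 0 = 0"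
  by (simp add: norm_1_def)

lemma norm_1_triangle: "norm_1 (a + b) \<le> norm_1 a + norm_1 b"
  by (simp add: norm_1_def flip: sum.distrib) (intro sum_mono abs_triangle_ineq)

lemma norm_1_scaleR: "norm_1 (t *\<^sub>R b) = \<bar>t\<bar> * norm_1 b"
  by (simp add: norm_1_def abs_mult sum_distrib_left)

lemma norm_1_sum: "norm_1 (\<Sum>i\<in>I. f i) \<le> (\<Sum>i\<in>I. norm_1 (f i))"
  by (induction I rule: infinite_finite_induct)
    (auto simp: norm_1_zero intro: order_trans[OF norm_1_triangle])

lemma norm_1_subvec_Un:
  assumes "S \<inter> R = {}"
  shows "norm_1 (subvec b (S \<union> R)) = norm_1 (subvec b S) + norm_1 (subvec b R)"
  unfolding norm_1_def sum.distrib[symmetric]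
  using assms by (intro sum.cong) (auto simp: subvec_nth)

text \<open>Hoelder's inequality for the dual pair of the maximum norm and the 1-norm.\<close>

lemma inner_le_infnorm_norm_1:
  fixes a b :: "real^'m"
  shows "inner a b \<le> infnorm a * norm_1 b"
proof -
  have "a $ i * b $ i \<le> infnorm a * \<bar>b $ i\<bar>" for i
  proof -
    have "a $ i * b $ i \<le> \<bar>a $ i\<bar> * \<bar>b $ i\<bar>"
      by (metis abs_ge_self abs_mult)
    also have "\<dots> \<le> infnorm a * \<bar>b $ i\<bar>"
      by (intro mult_right_mono component_le_infnorm_cart) auto
    finally show ?thesis .
  qed
  then show ?thesis
    by (simp add: inner_vec_def norm_1_def sum_distrib_left sum_mono)
qed

text \<open>With this and the next two lemmas, products with padded submatrices become products with
  \<open>A\<close> and restrictions of vectors, so later calculations handle vectors only.\<close>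

lemma subcols_mult_vec: "subcols A S *v b = A *v subvec b S"
  by (auto simp: vec_eq_iff matrix_vector_mult_def subcols_def subvec_nth intro!: sum.cong)

lemma transpose_subcols_mult_vec: "transpose (subcols A S) *v z = subvec (transpose A *v z) S"
  by (auto simp: vec_eq_iff matrix_vector_mult_def subcols_def transpose_def subvec_nth)

lemma gram_mult_vec: "gram A S *v v = subvec (transpose A *v (A *v subvec v S)) S"
  by (simp add: gram_def subcols_mult_vec transpose_subcols_mult_vec
      flip: matrix_vector_mul_assoc)

lemma id_on_mult_vec: "id_on S *v v = subvec v S"
proof -
  have "(\<Sum>j\<in>UNIV. (if i = j \<and> i \<in> S then 1 else 0) * v $ j) = (if i \<in> S then v $ i else 0)" for i
    by (cases "i \<in> S") (simp_all add: if_distrib[of "\<lambda>c. c * _"] cong: if_cong)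
  then show ?thesis
    by (simp add: vec_eq_iff matrix_vector_mult_def id_on_def subvec_nth)
qed

lemma inner_matrix_vec:
  fixes A :: "real^'m^'n"
  shows "inner z (A *v v) = inner (transpose A *v z) v"
  \<comment> \<open>\<open>transpose_matrix_vector\<close> is kept out of the simpset so that
    correlations stay in the form \<open>transpose A *v z\<close>. It is applied only here, to move
    \<open>A\<close> across the inner product.\<close>
  by (simp add: transpose_matrix_vector dot_lmul_matrix)

lemma orthogonal_to_columns:
  fixes A :: "real^'m^'n"
  assumes "subvec (transpose A *v r) S = 0" "subvec v S = v"
  shows "inner r (A *v v) = 0"
  using assms inner_subvec[of "transpose A *v r" S v] by (simp add: inner_matrix_vec)

lemma norm_mult_vec_le_spectral_norm: "norm (B *v v) \<le> spectral_norm B * norm v"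
  unfolding spectral_norm_def by (rule onorm) (rule matrix_vector_mul_bounded_linear)

lemma spectral_norm_nonneg: "spectral_norm B \<ge> 0"
  unfolding spectral_norm_def by (rule onorm_pos_le) (rule matrix_vector_mul_bounded_linear)

section \<open>Invertible blocks\<close>

lemma inverse_on_inv_on: "invertible_on S G \<Longrightarrow> inverse_on S G (inv_on S G)"
  unfolding invertible_on_def by (auto simp: inv_on_eqI)

text \<open>The block inverse vanishes outside \<open>S\<close> times \<open>S\<close>, so it
  inverts only up to restriction to \<open>S\<close>, while restrictions next to it can be absorbed
  or inserted at will.\<close>

lemma inv_on_mult_vec:
  assumes "invertible_on S G"
  shows "inv_on S G *v (G *v v) = subvec v S"
    and "G *v (inv_on S G *v v) = subvec v S"
    and "subvec (inv_on S G *v v) S = inv_on S G *v v"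
    and "inv_on S G *v subvec v S = inv_on S G *v v"
  using inverse_on_inv_on[OF assms] id_on_mult[of S "inv_on S G"]
  unfolding inverse_on_def
  by (simp_all add: matrix_vector_mul_assoc flip: id_on_mult_vec)

text \<open>Filling the complementary diagonal block of \<open>G\<close> with the identity gives an
  injective, hence invertible, square matrix \<open>F\<close>. Cutting its inverse \<open>K\<close>
  back to \<open>S\<close> gives the block inverse \<open>H = E ** K\<close>.\<close>

lemma invertible_onI:
  fixes G :: "real^'m^'m"
  assumes G: "\<forall>i j. i \<notin> S \<or> j \<notin> S \<longrightarrow> G $ i $ j = 0"
    and inj: "\<And>v. subvec v S = v \<Longrightarrow> G *v v = 0 \<Longrightarrow> v = 0"
  shows "invertible_on S G"
proof -
  define E where "E = (id_on S :: real^'m^'m)"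
  have EG: "E ** G = G" "G ** E = G"
    using id_on_mult[OF G] by (simp_all add: E_def)
  have EE: "E ** E = E"
    unfolding E_def by (rule id_on_mult) (simp add: id_on_def)
  define F where "F = G + (mat 1 - E)"
  have F: "F *v v = G *v v + (v - E *v v)" for v
    by (simp add: F_def matrix_vector_mult_add_rdistrib matrix_vector_mult_diff_rdistrib)
  have "E *v (F *v v) = G *v v" "F *v (E *v v) = G *v v" for v
    unfolding F by (simp_all add: matrix_vector_right_distrib matrix_vector_mult_diff_distrib
        matrix_vector_mul_assoc EG EE)
  then have EF: "E ** F = G" "F ** E = G"
    by (simp_all add: matrix_eq flip: matrix_vector_mul_assoc)
  have "v = 0" if "F *v v = 0" for v
  proof -
    have "G *v v = E *v (F *v v)"
      by (simp add: matrix_vector_mul_assoc EF)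
    then have "G *v v = 0"
      by (simp only: that matrix_vector_mult_0_right)
    moreover from this have "F *v v = v - E *v v"
      by (simp only: F add_0)
    then have "E *v v = v"
      by (metis that right_minus_eq)
    ultimately show ?thesis
      using inj[of v] by (simp add: E_def id_on_mult_vec)
  qed
  then obtain K where KF: "K ** F = mat 1"
    using matrix_left_invertible_ker[of F] by auto
  then have FK: "F ** K = mat 1"
    by (simp add: matrix_left_right_inverse)
  \<comment> \<open>\<open>E\<close> commutes with \<open>F\<close>, hence with its inverse; so
    cutting \<open>K\<close> on one side cuts it on both.\<close>
  have EK: "E ** K = K ** E"
  proof -
    have "E ** K = (K ** F) ** (E ** K)" by (simp add: KF)
    also have "\<dots> = K ** (F ** E) ** K" by (simp only: matrix_mul_assoc)
    also have "\<dots> = K ** (E ** F) ** K" by (simp only: EF)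
    also have "\<dots> = (K ** E) ** (F ** K)" by (simp only: matrix_mul_assoc)
    finally show ?thesis by (simp add: FK)
  qed
  define H where "H = E ** K"
  have "E ** H = H" "H ** E = H"
    by (simp_all add: H_def EE matrix_mul_assoc) (simp add: EK EE flip: matrix_mul_assoc)
  have supp: "H $ i $ j = 0" if "i \<notin> S \<or> j \<notin> S" for i j
  proof -
    have "(E ** H) $ i $ j = 0" if "i \<notin> S"
      using that by (simp add: matrix_matrix_mult_def E_def id_on_def)
    moreover have "(H ** E) $ i $ j = 0" if "j \<notin> S"
      using that by (auto simp: matrix_matrix_mult_def E_def id_on_def intro!: sum.neutral)
    ultimately show ?thesis
      using that \<open>E ** H = H\<close> \<open>H ** E = H\<close> by metis
  qed
  have "G ** H = (E ** F) ** K" "H ** G = K ** (F ** E)"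
    by (simp_all add: H_def EF EG matrix_mul_assoc) (simp add: EK EG flip: matrix_mul_assoc)
  then have "G ** H = E" "H ** G = E"
    by (simp_all add: FK flip: matrix_mul_assoc) (simp add: KF matrix_mul_assoc)
  with supp show ?thesis
    unfolding invertible_on_def inverse_on_def E_def by blast
qed

lemma invertible_gram_inj:
  assumes "invertible_on S (gram A S)" "subvec v S = v" "A *v v = 0"
  shows "v = 0"
  using inv_on_mult_vec(1)[OF assms(1), of v] assms(2,3) by (simp add: gram_mult_vec subvec_zero)

lemma gram_inner:
  fixes A :: "real^'m^'n"
  assumes "subvec v S = v"
  shows "inner v (gram A S *v v) = (norm (A *v v))\<^sup>2"
proof -
  have "inner v (gram A S *v v) = inner v (transpose A *v (A *v v))"
    using assms by (simp add: gram_mult_vec flip: inner_subvec)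
  also have "\<dots> = inner (A *v v) (A *v v)"
    by (subst inner_commute) (rule inner_matrix_vec[symmetric])
  finally show ?thesis
    by (simp add: power2_norm_eq_inner)
qed

lemma gram_outside: "\<forall>i j. i \<notin> S \<or> j \<notin> S \<longrightarrow> gram A S $ i $ j = 0"
  by (auto simp: gram_def matrix_matrix_mult_def transpose_def subcols_def)

text \<open>By \<open>gram_inner\<close>, a supported vector killed by the Gram matrix is killed by
  \<open>A\<close>, and injectivity of \<open>A\<close> passes to fewer columns.\<close>

lemma invertible_gram_subset:
  fixes A :: "real^'m^'n"
  assumes "invertible_on S (gram A S)" "R \<subseteq> S"
  shows "invertible_on R (gram A R)"
proof (rule invertible_onI[OF gram_outside])
  fix v assume v: "subvec v R = v" "gram A R *v v = 0"
  then have "A *v v = 0"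
    using gram_inner[OF v(1), of A] by simp
  then show "v = 0"
    using invertible_gram_inj[OF assms(1)] subvec_mono[OF v(1) assms(2)] by blast
qed

section \<open>The projection and the Schur complement; block elimination\<close>

lemma M_proj_mult_vec:
  assumes "invertible_on T (gram A T)"
  shows "M_proj A T *v z = z - A *v (inv_on T (gram A T) *v (transpose A *v z))"
  using inv_on_mult_vec[OF assms]
  by (simp add: M_proj_def matrix_vector_mult_diff_rdistrib subcols_mult_vec
      transpose_subcols_mult_vec flip: matrix_vector_mul_assoc)

lemma Schur_mult_vec:
  assumes "invertible_on T (gram A T)"
  shows "(transpose (subcols A D) ** M_proj A T ** subcols A D) *v v =
    subvec (transpose A *v (A *v (subvec v D
      - inv_on T (gram A T) *v (transpose A *v (A *v subvec v D))))) D"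
  by (simp add: M_proj_mult_vec[OF assms] subcols_mult_vec transpose_subcols_mult_vec
      matrix_vector_mult_diff_distrib subvec_diff flip: matrix_vector_mul_assoc)

text \<open>Let \<open>v\<close> on \<open>D\<close> be killed by the Schur complement, and let
  \<open>t\<close> be the coefficients of the least squares fit of \<open>A v\<close> by the columns
  in \<open>T\<close>. Then \<open>A (v - t)\<close> is orthogonal to all columns in
  \<open>T\<close> and \<open>D\<close>, hence to itself, so \<open>v = t\<close>. This vector lives
  on two disjoint sets and is zero.\<close>

lemma invertible_Schur:
  fixes A :: "real^'m^'n"
  assumes inv: "invertible_on (T \<union> D) (gram A (T \<union> D))" and disj: "T \<inter> D = {}"
  shows "invertible_on D (transpose (subcols A D) ** M_proj A T ** subcols A D)"
proof (rule invertible_onI)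
  show "\<forall>i j. i \<notin> D \<or> j \<notin> D \<longrightarrow>
      (transpose (subcols A D) ** M_proj A T ** subcols A D) $ i $ j = 0"
    by (auto simp: matrix_matrix_mult_def transpose_def subcols_def)
next
  have invT: "invertible_on T (gram A T)"
    using invertible_gram_subset[OF inv] by blast
  fix v assume v: "subvec v D = v"
    and 0: "(transpose (subcols A D) ** M_proj A T ** subcols A D) *v v = 0"
  define t where "t = inv_on T (gram A T) *v (transpose A *v (A *v v))"
  have t: "subvec t T = t"
    unfolding t_def by (rule inv_on_mult_vec[OF invT])
  have supp: "subvec (v - t) (T \<union> D) = v - t"
    using subvec_mono[OF t] subvec_mono[OF v] by (simp add: subvec_diff)
  have D: "subvec (transpose A *v (A *v (v - t))) D = 0"
    using 0 v by (simp add: Schur_mult_vec[OF invT] t_def)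
  have "subvec (transpose A *v (A *v t)) T = subvec (transpose A *v (A *v v)) T"
    using inv_on_mult_vec(2)[OF invT, of "transpose A *v (A *v v)"]
    by (simp add: gram_mult_vec inv_on_mult_vec[OF invT] flip: t_def) (simp add: t)
  then have T: "subvec (transpose A *v (A *v (v - t))) T = 0"
    by (simp add: matrix_vector_mult_diff_distrib subvec_diff)
  have "inner (A *v (v - t)) (A *v v) = 0" "inner (A *v (v - t)) (A *v t) = 0"
    using orthogonal_to_columns D T v t by blast+
  then have "inner (A *v (v - t)) (A *v (v - t)) = 0"
    by (simp only: matrix_vector_mult_diff_distrib inner_diff_right diff_zero)
  then have "v = t"
    using invertible_gram_inj[OF inv supp] by simp
  then have "v = subvec (subvec v T) D"
    using v t by simp
  then show "v = 0"
    using disj by (simp add: subvec_subvec) (simp add: subvec_def flip: zero_vec_def)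
qed

text \<open>The rows in \<open>T\<close> express the \<open>T\<close> part of \<open>v\<close>
  through its \<open>D\<close> part; substituting this into the rows in \<open>D\<close> leaves the
  Schur complement system, which \<open>P_mat\<close> solves. The right-hand side \<open>f\<close>
  is arbitrary because the lemma serves both the recovery coefficient and the error bound.\<close>

lemma normal_equations_blocks:
  fixes A :: "real^'m^'n"
  assumes inv: "invertible_on (T \<union> D) (gram A (T \<union> D))" and disj: "T \<inter> D = {}"
    and v: "subvec v (T \<union> D) = v"
    and eq: "subvec (transpose A *v (A *v v)) (T \<union> D) = subvec f (T \<union> D)"
  shows "subvec v D = P_mat A T D *v
      (f - transpose A *v (A *v (inv_on T (gram A T) *v f)))" (is ?D)
    and "subvec v T = inv_on T (gram A T) *v (f - transpose A *v (A *v subvec v D))" (is ?T)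
proof -
  have invT: "invertible_on T (gram A T)"
    using invertible_gram_subset[OF inv] by blast
  let ?I = "inv_on T (gram A T)"
  have split: "v = subvec v T + subvec v D"
    using v disj unfolding subvec_eq_self_iff by (auto simp: vec_eq_iff subvec_nth)
  have "subvec (subvec (transpose A *v (A *v v)) (T \<union> D)) T = subvec (subvec f (T \<union> D)) T"
    "subvec (subvec (transpose A *v (A *v v)) (T \<union> D)) D = subvec (subvec f (T \<union> D)) D"
    using eq by simp_all
  then have fT: "subvec (transpose A *v (A *v v)) T = subvec f T"
    and fD: "subvec (transpose A *v (A *v v)) D = subvec f D"
    by (simp_all add: subvec_subvec Int_absorb1)
  have AA: "transpose A *v (A *v v)
      = transpose A *v (A *v subvec v T) + transpose A *v (A *v subvec v D)"
    by (subst split) (simp only: matrix_vector_right_distrib)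
  have "gram A T *v v = subvec (f - transpose A *v (A *v subvec v D)) T"
    using fT by (simp add: gram_mult_vec AA subvec_add subvec_diff algebra_simps)
  then show T: ?T
    using inv_on_mult_vec[OF invT] by metis
  have "(transpose (subcols A D) ** M_proj A T ** subcols A D) *v v =
      subvec (f - transpose A *v (A *v (?I *v f))) D"
    using fD unfolding Schur_mult_vec[OF invT]
    by (simp add: AA T matrix_vector_mult_diff_distrib subvec_add subvec_diff algebra_simps)
  then show ?D
    unfolding P_mat_def using inv_on_mult_vec[OF invertible_Schur[OF inv disj]] by metis
qed

section \<open>Minimizers on the support\<close>

lemma mod_bpdn_obj_0: "mod_bpdn_obj A y 0 T = sq_loss A y"
  by (simp add: mod_bpdn_obj_def fun_eq_iff)

text \<open>Treating least squares as the case \<gamma> = 0 lets the results on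
  \<open>d_min\<close>, stated for \<gamma> \<ge> 0, cover \<open>c_min\<close> as well.\<close>

lemma c_min_eq_d_min: "c_min A y T D = d_min A y 0 T D"
  by (simp add: c_min_def d_min_def mod_bpdn_obj_0)

lemma continuous_on_mod_bpdn_obj: "continuous_on S (mod_bpdn_obj A y \<gamma> T)"
proof -
  have 1: "continuous_on S (\<lambda>b. subvec b R $ i)" for R :: "'a set" and i :: 'a
    unfolding subvec_nth by (cases "i \<in> R") (auto intro!: continuous_intros)
  have 2: "continuous_on S ((*v) A)"
    using matrix_vector_mul_bounded_linear[of A] by (rule linear_continuous_on)
  show ?thesis
    unfolding mod_bpdn_obj_def[abs_def] sq_loss_def norm_1_def
    by (intro continuous_intros 1 2)
qed

lemma closed_subvec_eq: "closed {b :: real^'m. subvec b S = b}"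
proof -
  have "{b :: real^'m. subvec b S = b} = (\<Inter>i\<in>- S. {b. b $ i = 0})"
    by (auto simp: subvec_eq_self_iff)
  then show ?thesis
    by (auto intro!: closed_INT closed_Collect_eq continuous_intros)
qed

text \<open>Vectors that do no worse than \<open>0\<close> form a bounded set: their loss bounds
  \<open>A b\<close>, and \<open>A\<close> has a left inverse on vectors supported on
  \<open>S\<close>. A minimizer over a ball containing them is therefore a minimizer over all
  supported vectors.\<close>

lemma exists_minimizer_on_support:
  fixes A :: "real^'m^'n"
  assumes inv: "invertible_on S (gram A S)" and \<gamma>: "\<gamma> \<ge> 0"
  obtains d where "subvec d S = d"
    and "\<And>b. subvec b S = b \<Longrightarrow> mod_bpdn_obj A y \<gamma> T d \<le> mod_bpdn_obj A y \<gamma> T b"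
proof -
  let ?L = "mod_bpdn_obj A y \<gamma> T"
  let ?K = "spectral_norm (inv_on S (gram A S) ** transpose (subcols A S))"
  let ?C = "{b. subvec b S = b} \<inter> cball 0 (?K * (2 * norm y))"
  have bound: "norm b \<le> ?K * (2 * norm y)" if b: "subvec b S = b" and le: "?L b \<le> ?L 0" for b
  proof -
    have "sq_loss A y b \<le> ?L b"
      using \<gamma> by (simp add: mod_bpdn_obj_def norm_1_nonneg)
    also have "\<dots> \<le> 1/2 * (norm y)\<^sup>2"
      using le by (simp add: mod_bpdn_obj_def sq_loss_def subvec_zero norm_1_zero)
    finally have "norm (y - A *v b) \<le> norm y"
      by (simp add: sq_loss_def power2_le_iff_abs_le abs_le_square_iff[symmetric])
    then have Ab: "norm (A *v b) \<le> 2 * norm y"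
      using norm_triangle_ineq4[of y "y - A *v b"] by simp
    have "b = (inv_on S (gram A S) ** transpose (subcols A S)) *v (A *v b)"
      using inv_on_mult_vec(1)[OF inv, of b] b
      by (simp add: gram_mult_vec transpose_subcols_mult_vec flip: matrix_vector_mul_assoc)
    then have "norm b \<le> ?K * norm (A *v b)"
      using norm_mult_vec_le_spectral_norm by metis
    also have "\<dots> \<le> ?K * (2 * norm y)"
      using Ab by (intro mult_left_mono spectral_norm_nonneg)
    finally show ?thesis .
  qed
  have "compact ?C"
    by (intro closed_Int_compact closed_subvec_eq compact_cball)
  moreover have "0 \<in> ?C"
    by (simp add: subvec_zero spectral_norm_nonneg)
  ultimately have "\<exists>d\<in>?C. \<forall>b\<in>?C. ?L d \<le> ?L b"
    by (intro continuous_attains_inf continuous_on_mod_bpdn_obj) (use \<open>0 \<in> ?C\<close> in blast)+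
  then obtain d where d: "d \<in> ?C" and min: "\<And>b. b \<in> ?C \<Longrightarrow> ?L d \<le> ?L b"
    by blast
  have "?L d \<le> ?L b" if b: "subvec b S = b" for b
  proof (cases "?L b \<le> ?L 0")
    case True
    then show ?thesis
      using b bound by (intro min) simp
  next
    case False
    then show ?thesis
      using min[OF \<open>0 \<in> ?C\<close>] by simp
  qed
  then show thesis
    using that d by blast
qed

text \<open>This is the parallelogram law. It measures how strictly convex the loss is between two
  points that \<open>A\<close> distinguishes.\<close>

lemma sq_loss_midpoint:
  fixes A :: "real^'m^'n"
  shows "sq_loss A y ((1/2) *\<^sub>R (b + d))
    = (sq_loss A y b + sq_loss A y d) / 2 - (norm (A *v (b - d)))\<^sup>2 / 8"
proof -
  have "y - A *v ((1/2) *\<^sub>R (b + d)) = (1/2) *\<^sub>R ((y - A *v b) + (y - A *v d))"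
    by (simp add: matrix_vector_mult_scaleR matrix_vector_right_distrib vec_eq_iff field_simps)
  moreover have "A *v (b - d) = (y - A *v d) - (y - A *v b)"
    by (simp add: matrix_vector_mult_diff_distrib)
  moreover have "(norm ((1/2) *\<^sub>R (p + q)))\<^sup>2 = ((norm p)\<^sup>2 + (norm q)\<^sup>2) / 2 - (norm (q - p))\<^sup>2 / 4"
    for p q :: "real^'n"
    by (simp add: power2_norm_eq_inner inner_add inner_diff inner_commute field_simps)
  ultimately show ?thesis
    unfolding sq_loss_def by (simp only:) (simp add: field_simps)
qed

text \<open>The midpoint of two minimizers would be better than both unless \<open>A\<close> maps
  them to the same vector, and \<open>A\<close> is injective on vectors supported on
  \<open>S\<close>.\<close>

lemma minimizer_on_support_unique:
  fixes A :: "real^'m^'n"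
  assumes inv: "invertible_on S (gram A S)" and \<gamma>: "\<gamma> \<ge> 0"
    and d: "subvec d S = d"
    and min: "\<And>b. subvec b S = b \<Longrightarrow> mod_bpdn_obj A y \<gamma> T d \<le> mod_bpdn_obj A y \<gamma> T b"
    and b: "subvec b S = b" and le: "mod_bpdn_obj A y \<gamma> T b \<le> mod_bpdn_obj A y \<gamma> T d"
  shows "b = d"
proof -
  let ?L = "mod_bpdn_obj A y \<gamma> T"
  define m where "m = (1/2) *\<^sub>R (b + d)"
  have "norm_1 (subvec m (- T)) \<le> (norm_1 (subvec b (- T)) + norm_1 (subvec d (- T))) / 2"
    using norm_1_triangle[of "subvec b (- T)" "subvec d (- T)"]
    by (simp add: m_def subvec_scaleR subvec_add norm_1_scaleR)
  then have "\<gamma> * norm_1 (subvec m (- T))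
      \<le> \<gamma> * ((norm_1 (subvec b (- T)) + norm_1 (subvec d (- T))) / 2)"
    using \<gamma> by (rule mult_left_mono)
  then have "?L m \<le> (?L b + ?L d) / 2 - (norm (A *v (b - d)))\<^sup>2 / 8"
    unfolding mod_bpdn_obj_def m_def sq_loss_midpoint by (simp add: field_simps)
  moreover have "?L d \<le> ?L m"
    using b d by (intro min) (simp add: m_def subvec_scaleR subvec_add)
  ultimately have "(norm (A *v (b - d)))\<^sup>2 / 8 \<le> (?L b + ?L d) / 2 - ?L d"
    by linarith
  also have "\<dots> \<le> 0"
    using le by simp
  finally have "(norm (A *v (b - d)))\<^sup>2 \<le> 0"
    by simp
  then show ?thesis
    using invertible_gram_inj[OF inv, of "b - d"] b d by (simp add: subvec_diff)
qed

lemma d_min_minimizes: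
  fixes A :: "real^'m^'n"
  assumes inv: "invertible_on (T \<union> D) (gram A (T \<union> D))" and \<gamma>: "\<gamma> \<ge> 0"
  shows "subvec (d_min A y \<gamma> T D) (T \<union> D) = d_min A y \<gamma> T D" (is ?supp)
    and "subvec b (T \<union> D) = b \<Longrightarrow>
      mod_bpdn_obj A y \<gamma> T (d_min A y \<gamma> T D) \<le> mod_bpdn_obj A y \<gamma> T b" (is "_ \<Longrightarrow> ?min b")
proof -
  obtain d where d: "subvec d (T \<union> D) = d"
    and min: "\<And>b. subvec b (T \<union> D) = b \<Longrightarrow> mod_bpdn_obj A y \<gamma> T d \<le> mod_bpdn_obj A y \<gamma> T b"
    using exists_minimizer_on_support[OF assms] by blast
  have "d_min A y \<gamma> T D = d"
    unfolding d_min_def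
  proof (rule the_equality)
    show "is_arg_min (mod_bpdn_obj A y \<gamma> T) (\<lambda>b. subvec b (- (T \<union> D)) = 0) d"
      using d min unfolding is_arg_min_def subvec_Compl_eq_0_iff by (auto simp: not_less)
  next
    fix b assume "is_arg_min (mod_bpdn_obj A y \<gamma> T) (\<lambda>b. subvec b (- (T \<union> D)) = 0) b"
    then show "b = d"
      unfolding is_arg_min_def subvec_Compl_eq_0_iff
      using minimizer_on_support_unique[OF assms d min] d by (meson not_less)
  qed
  with d min show ?supp "subvec b (T \<union> D) = b \<Longrightarrow> ?min b"
    by auto
qed

text \<open>First-order condition at \<open>t = 0\<close>, obtained without derivatives: take a
  small \<open>t\<close> with the sign of \<rho> and divide by its absolute value.\<close>

lemma abs_le_of_quadratic:
  fixes \<rho> q \<kappa> :: real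
  assumes "\<And>t. 0 \<le> - t * \<rho> + t\<^sup>2 * q + \<kappa> * \<bar>t\<bar>"
  shows "\<bar>\<rho>\<bar> \<le> \<kappa>"
proof (rule field_le_epsilon)
  fix e :: real assume e: "e > 0"
  \<comment> \<open>This step size keeps the quadratic term, after division by \<open>s\<close>,
    below \<open>e\<close>.\<close>
  define s where "s = e / (\<bar>q\<bar> + 1)"
  have s: "s > 0" "s * \<bar>q\<bar> \<le> e"
    using e by (simp_all add: s_def field_simps)
  have "0 \<le> - (sgn \<rho> * s) * \<rho> + (sgn \<rho> * s)\<^sup>2 * q + \<kappa> * \<bar>sgn \<rho> * s\<bar>"
    by (rule assms)
  then have "\<rho> \<noteq> 0 \<Longrightarrow> s * \<bar>\<rho>\<bar> \<le> s * (s * q + \<kappa>)"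
    using s by (auto simp: sgn_if abs_if power2_eq_square algebra_simps split: if_splits)
  then have "\<rho> \<noteq> 0 \<Longrightarrow> \<bar>\<rho>\<bar> \<le> s * q + \<kappa>"
    using s by simp
  \<comment> \<open>This settles \<rho> = 0, where the point \<open>sgn \<rho> * s\<close> is
    \<open>0\<close> and gives no information: in the sum of the inequalities at \<open>s\<close>
    and \<open>- s\<close> the linear terms cancel.\<close>
  moreover have "0 \<le> s * q + \<kappa>"
  proof -
    have "0 \<le> (- s * \<rho> + s\<^sup>2 * q + \<kappa> * \<bar>s\<bar>) + (- (- s) * \<rho> + (- s)\<^sup>2 * q + \<kappa> * \<bar>- s\<bar>)"
      by (intro add_nonneg_nonneg assms)
    also have "\<dots> = 2 * s * (s * q + \<kappa>)"
      using s by (simp add: power2_eq_square algebra_simps)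
    finally show ?thesis
      using s by (simp add: zero_le_mult_iff)
  qed
  ultimately have "\<bar>\<rho>\<bar> \<le> s * q + \<kappa>"
    by fastforce
  moreover have "s * q \<le> s * \<bar>q\<bar>"
    using s by (intro mult_left_mono) auto
  ultimately show "\<bar>\<rho>\<bar> \<le> \<kappa> + e"
    using s by linarith
qed

text \<open>Along coordinate \<open>i\<close> the loss is quadratic with slope minus the
  correlation, while the penalty grows by at most \<gamma> times the step, and not at all for
  \<open>i\<close> in \<open>T\<close>. The result is the subgradient condition in
  coordinates.\<close>

lemma d_min_stationary:
  fixes A :: "real^'m^'n"
  assumes inv: "invertible_on (T \<union> D) (gram A (T \<union> D))" and \<gamma>: "\<gamma> \<ge> 0"
    and i: "i \<in> T \<union> D"
  shows "\<bar>(transpose A *v (y - A *v d_min A y \<gamma> T D)) $ i\<bar> \<le> (if i \<in> T then 0 else \<gamma>)"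
proof (rule abs_le_of_quadratic)
  fix t :: real
  let ?L = "mod_bpdn_obj A y \<gamma> T"
  define d where "d = d_min A y \<gamma> T D"
  define \<rho> where "\<rho> = (transpose A *v (y - A *v d)) $ i"
  define a :: "real^'m" where "a = axis i 1"
  have a: "subvec a R = (if i \<in> R then a else 0)" for R
    by (auto simp: a_def vec_eq_iff subvec_nth axis_def)
  have "norm_1 a = 1"
    by (simp add: norm_1_def a_def axis_def if_distrib[of abs] cong: if_cong)
  then have "norm_1 (subvec (t *\<^sub>R a) (- T)) = (if i \<in> T then 0 else \<bar>t\<bar>)"
    by (simp add: subvec_scaleR norm_1_scaleR a norm_1_zero)
  then have "norm_1 (subvec (d + t *\<^sub>R a) (- T)) \<le> norm_1 (subvec d (- T)) + (if i \<in> T then 0 else \<bar>t\<bar>)"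
    unfolding subvec_add by (metis norm_1_triangle)
  then have "\<gamma> * norm_1 (subvec (d + t *\<^sub>R a) (- T))
      \<le> \<gamma> * (norm_1 (subvec d (- T)) + (if i \<in> T then 0 else \<bar>t\<bar>))"
    using \<gamma> by (rule mult_left_mono)
  moreover have "?L d \<le> ?L (d + t *\<^sub>R a)"
    unfolding d_def using i
    by (intro d_min_minimizes[OF inv \<gamma>])
      (auto simp: subvec_add subvec_scaleR a d_min_minimizes(1)[OF inv \<gamma>])
  moreover have "sq_loss A y (d + t *\<^sub>R a) = sq_loss A y d - t * \<rho> + t\<^sup>2 * ((norm (A *v a))\<^sup>2 / 2)"
  proof -
    have "inner (y - A *v d) (A *v a) = \<rho>"
      unfolding inner_matrix_vec by (simp add: a_def \<rho>_def inner_axis)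
    moreover have "y - A *v (d + t *\<^sub>R a) = (y - A *v d) - t *\<^sub>R (A *v a)"
      by (simp add: matrix_vector_right_distrib matrix_vector_mult_scaleR)
    ultimately show ?thesis
      unfolding sq_loss_def by (simp only: norm_diff_power2) (simp add: power_mult_distrib)
  qed
  ultimately have "0 \<le> - t * \<rho> + t\<^sup>2 * ((norm (A *v a))\<^sup>2 / 2) + (if i \<in> T then 0 else \<gamma>) * \<bar>t\<bar>"
    unfolding mod_bpdn_obj_def by (auto simp: distrib_left split: if_splits)
  then show "0 \<le> - t * (transpose A *v (y - A *v d_min A y \<gamma> T D)) $ i
      + t\<^sup>2 * ((norm (A *v a))\<^sup>2 / 2) + (if i \<in> T then 0 else \<gamma>) * \<bar>t\<bar>"
    unfolding \<rho>_def d_def .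
qed

text \<open>For \<gamma> = 0 the stationarity bound is zero in every coordinate of the
  support.\<close>

lemma c_min_normal_equations:
  fixes A :: "real^'m^'n"
  assumes "invertible_on (T \<union> D) (gram A (T \<union> D))"
  shows "subvec (transpose A *v (y - A *v c_min A y T D)) (T \<union> D) = 0"
  using d_min_stationary[OF assms order_refl, where y = y]
  by (auto simp: vec_eq_iff subvec_nth c_min_eq_d_min split: if_splits)

section \<open>The exact recovery coefficient\<close>

text \<open>\<open>B *v u\<close> combines the columns of \<open>B\<close> with weights from
  \<open>u\<close>. Bounding only the columns that \<open>u\<close> uses matters, since the recovery
  coefficient controls only those outside \<open>T \<union> D\<close>.\<close>

lemma norm_1_matrix_mult_le:
  assumes "\<And>i. u $ i \<noteq> 0 \<Longrightarrow> norm_1 (column i B) \<le> \<kappa>"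
  shows "norm_1 (B *v u) \<le> \<kappa> * norm_1 u"
proof -
  have "norm_1 (B *v u) \<le> (\<Sum>i\<in>UNIV. norm_1 (u $ i *\<^sub>R column i B))"
    by (simp add: matrix_mult_sum scalar_mult_eq_scaleR norm_1_sum)
  also have "\<dots> \<le> (\<Sum>i\<in>UNIV. \<kappa> * \<bar>u $ i\<bar>)"
  proof (rule sum_mono)
    fix i
    show "norm_1 (u $ i *\<^sub>R column i B) \<le> \<kappa> * \<bar>u $ i\<bar>"
      using mult_left_mono[OF assms, of i "\<bar>u $ i\<bar>"]
      by (cases "u $ i = 0") (simp_all add: norm_1_scaleR norm_1_zero mult.commute)
  qed
  finally show ?thesis
    by (simp add: norm_1_def sum_distrib_left)
qed

lemma column_matrix_mult: "column i (B ** A) = B *v column i A"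
  by (simp add: vec_eq_iff column_def matrix_matrix_mult_def matrix_vector_mult_def)

lemma max0_ge: "finite X \<Longrightarrow> a \<in> X \<Longrightarrow> a \<le> max0 X"
  by (auto simp: max0_def)

text \<open>Here \<open>v\<close> is the least squares fit of \<open>A u\<close>. Eliminating its
  \<open>T\<close> part shows that its \<open>D\<close> part is \<open>(Q ** A) *v u\<close>, and
  the columns of \<open>Q ** A\<close> outside \<open>T \<union> D\<close> are the vectors whose
  norms enter \<open>ERC\<close>.\<close>

lemma norm_1_fit_le_ERC:
  fixes A :: "real^'m^'n"
  assumes inv: "invertible_on (T \<union> D) (gram A (T \<union> D))" and disj: "T \<inter> D = {}"
    and v: "subvec v (T \<union> D) = v"
    and fit: "subvec (transpose A *v (A *v u - A *v v)) (T \<union> D) = 0"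
    and u: "subvec u (- (T \<union> D)) = u"
  shows "norm_1 (subvec v D) \<le> (1 - ERC A T D) * norm_1 u"
proof -
  define Q where "Q = P_mat A T D ** transpose (subcols A D) ** M_proj A T"
  have invT: "invertible_on T (gram A T)"
    using invertible_gram_subset[OF inv] by blast
  have "subvec (transpose A *v (A *v v)) (T \<union> D) = subvec (transpose A *v (A *v u)) (T \<union> D)"
    using fit by (simp add: matrix_vector_mult_diff_distrib subvec_diff)
  then have "subvec v D = P_mat A T D *v (transpose A *v (M_proj A T *v (A *v u)))"
    using normal_equations_blocks(1)[OF inv disj v]
    by (simp add: M_proj_mult_vec[OF invT] matrix_vector_mult_diff_distrib)
  \<comment> \<open>\<open>P_mat\<close> ignores entries outside \<open>D\<close>, so the full
    transpose may be replaced by that of the columns in \<open>D\<close>.\<close>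
  also have "\<dots> = Q *v (A *v u)"
    using inv_on_mult_vec(4)[OF invertible_Schur[OF inv disj]]
    by (simp add: Q_def P_mat_def transpose_subcols_mult_vec flip: matrix_vector_mul_assoc)
  finally have "subvec v D = (Q ** A) *v u"
    by (simp add: matrix_vector_mul_assoc)
  moreover have "norm_1 (column \<omega> (Q ** A)) \<le> 1 - ERC A T D" if "u $ \<omega> \<noteq> 0" for \<omega>
  proof -
    have "\<omega> \<in> - (T \<union> D)"
      using that u unfolding subvec_eq_self_iff by blast
    then show ?thesis
      unfolding ERC_def column_matrix_mult Q_def by (simp add: max0_ge)
  qed
  ultimately show ?thesis
    by (simp add: norm_1_matrix_mult_le)
qed

text \<open>
  Given \<open>b\<close>, replace the part \<open>A u\<close> of \<open>A b\<close> coming from the entries \<open>u\<close> outside \<open>T \<union> D\<close> by its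
  least squares fit with columns in \<open>T \<union> D\<close>. This saves \<open>\<gamma> \<parallel>u\<parallel>\<^sub>1\<close> and adds at most
  \<open>\<gamma> (1 - ERC) \<parallel>u\<parallel>\<^sub>1\<close> to the penalty; the loss grows by at most \<open>\<gamma> ERC \<parallel>u\<parallel>\<^sub>1\<close>, minus half the
  squared norm of the residual \<open>r\<close> of the fit. If \<open>r = 0\<close> the loss does not change at all, so the
  comparison is strict although the lower bound on \<open>\<gamma>\<close> is not.
\<close>

lemma dominated_by_supported:
  fixes A :: "real^'m^'n"
  assumes inv: "invertible_on (T \<union> D) (gram A (T \<union> D))" and disj: "T \<inter> D = {}"
    and ERC: "ERC A T D > 0" and \<gamma>: "\<gamma> > 0"
    and corr: "infnorm (transpose (subcols A (- (T \<union> D))) *v (y - A *v c_min A y T D))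
      \<le> \<gamma> * ERC A T D"
    and b: "subvec b (- (T \<union> D)) \<noteq> 0"
  obtains b' where "subvec b' (T \<union> D) = b'"
    and "mod_bpdn_obj A y \<gamma> T b' < mod_bpdn_obj A y \<gamma> T b"
proof -
  define S where "S = T \<union> D"
  define c where "c = c_min A y T D"
  define u where "u = subvec b (- S)"
  define v where "v = inv_on S (gram A S) *v (transpose A *v (A *v u))"
  define b' where "b' = subvec b S + v"
  define r where "r = A *v u - A *v v"
  have invS: "invertible_on S (gram A S)"
    using inv by (simp add: S_def)
  have v: "subvec v S = v"
    unfolding v_def by (rule inv_on_mult_vec[OF invS])
  have u: "subvec u (- S) = u"
    by (simp add: u_def subvec_subvec)
  have b': "subvec b' S = b'"
    by (simp add: b'_def subvec_add subvec_subvec v)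
  have "subvec (transpose A *v (A *v v)) S = subvec (transpose A *v (A *v u)) S"
    using inv_on_mult_vec(2)[OF invS, of "transpose A *v (A *v u)"]
    by (simp add: gram_mult_vec v flip: v_def)
  then have r: "subvec (transpose A *v r) S = 0"
    by (simp add: r_def matrix_vector_mult_diff_distrib subvec_diff)
  have c: "subvec c S = c"
    unfolding c_def S_def c_min_eq_d_min by (rule d_min_minimizes[OF inv order_refl])
  have cn: "subvec (transpose A *v (y - A *v c)) S = 0"
    unfolding c_def S_def by (rule c_min_normal_equations[OF inv])

  have "norm_1 (subvec v D) \<le> (1 - ERC A T D) * norm_1 u"
    using norm_1_fit_le_ERC[OF inv disj] v r u by (simp add: S_def r_def)
  moreover have "norm_1 (subvec b' (- T)) \<le> norm_1 (subvec b D) + norm_1 (subvec v D)"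
  proof -
    have "subvec b' (- T) = subvec b D + subvec v D"
      using v disj unfolding b'_def subvec_eq_self_iff
      by (auto simp: vec_eq_iff subvec_nth S_def)
    then show ?thesis
      by (simp add: norm_1_triangle)
  qed
  moreover have "norm_1 (subvec b (- T)) = norm_1 (subvec b D) + norm_1 u"
  proof -
    have "- T = D \<union> - S"
      using disj by (auto simp: S_def)
    then show ?thesis
      unfolding u_def using norm_1_subvec_Un[of D "- S" b] by (simp add: S_def)
  qed
  ultimately have "norm_1 (subvec b' (- T)) + ERC A T D * norm_1 u \<le> norm_1 (subvec b (- T))"
    by (simp add: algebra_simps)
  then have pen: "\<gamma> * (norm_1 (subvec b' (- T)) + ERC A T D * norm_1 u)
      \<le> \<gamma> * norm_1 (subvec b (- T))"
    using \<gamma> by simp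

  \<comment> \<open>The hypothesis concerns the residual of \<open>c\<close>, not of
    \<open>b'\<close>. The two differ by a combination of columns in \<open>S\<close>, to which
    \<open>r\<close> is orthogonal.\<close>
  have inn_c: "inner (y - A *v b') r = inner (y - A *v c) r"
  proof -
    have "inner r (A *v (c - b')) = 0"
      using orthogonal_to_columns[OF r] c b' by (simp add: subvec_diff)
    then show ?thesis
      by (simp add: matrix_vector_mult_diff_distrib inner_diff inner_commute)
  qed
  \<comment> \<open>The residual of \<open>c\<close> is orthogonal to the columns in
    \<open>S\<close>, so the fitted part of \<open>r\<close> drops out and only correlations outside
    \<open>S\<close> remain.\<close>
  have "inner (y - A *v c) r = inner (y - A *v c) (A *v u)"
    using orthogonal_to_columns[OF cn v] by (simp add: r_def inner_diff_right)
  also have "\<dots> = inner (transpose (subcols A (- S)) *v (y - A *v c)) u"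
    unfolding inner_matrix_vec transpose_subcols_mult_vec inner_subvec u ..
  also have "\<dots> \<le> infnorm (transpose (subcols A (- S)) *v (y - A *v c)) * norm_1 u"
    by (rule inner_le_infnorm_norm_1)
  also have "\<dots> \<le> \<gamma> * ERC A T D * norm_1 u"
    using corr by (intro mult_right_mono norm_1_nonneg) (simp add: S_def c_def)
  finally have inn: "inner (y - A *v b') r \<le> \<gamma> * ERC A T D * norm_1 u"
    by (simp add: inn_c)
  have "y - A *v b = (y - A *v b') - r"
  proof -
    have "A *v b = A *v (subvec b S + u)"
      by (simp add: u_def subvec_Compl)
    then show ?thesis
      by (simp add: b'_def r_def matrix_vector_right_distrib)
  qed
  then have loss: "sq_loss A y b = sq_loss A y b' - inner (y - A *v b') r + (norm r)\<^sup>2 / 2"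
    unfolding sq_loss_def by (simp only: norm_diff_power2) simp
  have "mod_bpdn_obj A y \<gamma> T b' < mod_bpdn_obj A y \<gamma> T b"
  proof (cases "r = 0")
    case True
    have "u \<noteq> 0"
      using b by (simp add: u_def S_def)
    then have "\<gamma> * (ERC A T D * norm_1 u) > 0"
      using \<gamma> ERC by (intro mult_pos_pos norm_1_pos)
    then show ?thesis
      using pen loss True by (simp add: mod_bpdn_obj_def algebra_simps)
  next
    case False
    then have "(norm r)\<^sup>2 / 2 > 0"
      by simp
    with pen loss inn show ?thesis
      unfolding mod_bpdn_obj_def distrib_left by (simp only: mult.assoc)
  qed
  then show thesis
    using that b' by (simp add: S_def)
qed

text \<open>The equivalence delivers existence, uniqueness and identification of the global
  minimizer at once. Competitors on the support lose by uniqueness there, all others by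
  domination.\<close>

lemma d_min_unique_minimizer:
  fixes A :: "real^'m^'n"
  assumes inv: "invertible_on (T \<union> D) (gram A (T \<union> D))" and disj: "T \<inter> D = {}"
    and ERC: "ERC A T D > 0" and \<gamma>: "\<gamma> > 0"
    and corr: "\<gamma> \<ge> infnorm (transpose (subcols A (- (T \<union> D))) *v (y - A *v c_min A y T D))
      / ERC A T D"
  shows "is_arg_min (mod_bpdn_obj A y \<gamma> T) (\<lambda>_. True) b \<longleftrightarrow> b = d_min A y \<gamma> T D"
proof -
  let ?L = "mod_bpdn_obj A y \<gamma> T"
  let ?d = "d_min A y \<gamma> T D"
  have \<gamma>0: "\<gamma> \<ge> 0"
    using \<gamma> by simp
  note d = d_min_minimizes[OF inv \<gamma>0, where y = y]
  have corr': "infnorm (transpose (subcols A (- (T \<union> D))) *v (y - A *v c_min A y T D))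
      \<le> \<gamma> * ERC A T D"
    using corr ERC by (simp add: pos_divide_le_eq)
  have "?L ?d < ?L b" if "b \<noteq> ?d" for b
  proof (cases "subvec b (T \<union> D) = b")
    case True
    then show ?thesis
      using minimizer_on_support_unique[OF inv \<gamma>0 d True] that by (meson not_le)
  next
    case False
    then obtain b' where "subvec b' (T \<union> D) = b'" "?L b' < ?L b"
      using dominated_by_supported[OF inv disj ERC \<gamma> corr', of b]
      unfolding subvec_Compl_eq_0_iff by blast
    then show ?thesis
      using d(2)[of b'] by simp
  qed
  then show ?thesis
    unfolding is_arg_min_def by (metis less_asym)
qed

section \<open>The error bound\<close>

text \<open>The columns in \<open>T \<union> D\<close> reproduce \<open>A x\<close> exactly, so the
  residual of \<open>c_min\<close> is \<open>w - A *v e\<close>, and its normal equations are those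
  of a fit to \<open>w\<close>.\<close>

lemma c_min_error:
  fixes A :: "real^'m^'n"
  assumes inv: "invertible_on (T \<union> D) (gram A (T \<union> D))"
    and x: "subvec x (T \<union> D) = x" and y: "y = A *v x + w"
  shows "c_min A y T D - x
    = (inv_on (T \<union> D) (gram A (T \<union> D)) ** transpose (subcols A (T \<union> D))) *v w"
proof -
  let ?S = "T \<union> D"
  define e where "e = c_min A y T D - x"
  have e: "subvec e ?S = e"
    unfolding e_def c_min_eq_d_min subvec_diff d_min_minimizes[OF inv order_refl] x ..
  have "y - A *v c_min A y T D = w - A *v e"
    by (simp add: y e_def matrix_vector_mult_diff_distrib)
  then have "subvec (transpose A *v (A *v e)) ?S = subvec (transpose A *v w) ?S"
    using c_min_normal_equations[OF inv, where y = y]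
    by (simp add: matrix_vector_mult_diff_distrib subvec_diff)
  then have "gram A ?S *v e = transpose (subcols A ?S) *v w"
    by (simp add: gram_mult_vec transpose_subcols_mult_vec e)
  then have "e = inv_on ?S (gram A ?S) *v (transpose (subcols A ?S) *v w)"
    using inv_on_mult_vec(1)[OF inv, of e] e by simp
  then show ?thesis
    by (simp add: e_def matrix_vector_mul_assoc)
qed

lemma norm_c_min_diff_d_min_le:
  fixes A :: "real^'m^'n"
  assumes inv: "invertible_on (T \<union> D) (gram A (T \<union> D))" and disj: "T \<inter> D = {}"
    and \<gamma>: "\<gamma> \<ge> 0"
  shows "norm (c_min A y T D - d_min A y \<gamma> T D) \<le> \<gamma> * sqrt (card D) *
    sqrt ((spectral_norm (inv_on T (gram A T) ** transpose (subcols A T) **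
             subcols A D ** P_mat A T D))\<^sup>2 + (spectral_norm (P_mat A T D))\<^sup>2)"
proof -
  let ?I = "inv_on T (gram A T)"
  let ?P = "P_mat A T D"
  let ?Q = "?I ** transpose (subcols A T) ** subcols A D ** ?P"
  let ?d = "d_min A y \<gamma> T D"
  define e where "e = c_min A y T D - ?d"
  define f where "f = subvec (transpose A *v (y - A *v ?d)) (T \<union> D)"
  have invT: "invertible_on T (gram A T)"
    using invertible_gram_subset[OF inv] by blast
  note P = inv_on_mult_vec[OF invertible_Schur[OF inv disj], folded P_mat_def]
  have e: "subvec e (T \<union> D) = e"
    unfolding e_def c_min_eq_d_min subvec_diff d_min_minimizes[OF inv order_refl]
      d_min_minimizes[OF inv \<gamma>] ..
  have f_le: "\<bar>f $ i\<bar> \<le> (if i \<in> D then \<gamma> else 0)" for i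
    using d_min_stationary[OF inv \<gamma>, where y = y and i = i] disj
    by (auto simp: f_def subvec_nth split: if_splits)
  have fD: "subvec f D = f"
    unfolding subvec_eq_self_iff using f_le by (metis abs_le_zero_iff)
  have f0: "subvec f T = 0"
    using disj by (subst fD[symmetric]) (auto simp: vec_eq_iff subvec_nth)
  \<comment> \<open>Since \<open>f\<close> vanishes on \<open>T\<close>, the terms that eliminating
    \<open>T\<close> adds to the right-hand side disappear from both block formulas.\<close>
  then have If: "?I *v f = 0"
    by (metis inv_on_mult_vec(4)[OF invT] matrix_vector_mult_0_right)
  have "A *v e = (y - A *v ?d) - (y - A *v c_min A y T D)"
    by (simp add: e_def matrix_vector_mult_diff_distrib)
  then have "subvec (transpose A *v (A *v e)) (T \<union> D) = subvec f (T \<union> D)"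
    using c_min_normal_equations[OF inv, where y = y]
    by (simp only: matrix_vector_mult_diff_distrib[of "transpose A" "y - A *v ?d"] subvec_diff)
      (simp add: f_def subvec_subvec)
  note blocks = normal_equations_blocks[OF inv disj e this]
  have eD: "subvec e D = ?P *v f"
    using blocks(1) by (simp add: If)
  have "subvec e T = - (?Q *v f)"
    using blocks(2) inv_on_mult_vec(4)[OF invT]
    by (simp add: eD P matrix_vector_mult_diff_distrib If subcols_mult_vec
        transpose_subcols_mult_vec flip: matrix_vector_mul_assoc)
  then have eT: "norm (subvec e T) = norm (?Q *v f)"
    by simp
  \<comment> \<open>Pythagoras over the two blocks: both are images of the same \<open>f\<close>, so
    \<open>norm f\<close> factors out of the common square root.\<close>
  have "(norm e)\<^sup>2 = (norm (?Q *v f))\<^sup>2 + (norm (?P *v f))\<^sup>2"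
    using norm_subvec_Un_sq[OF disj, of e] by (simp add: e eD eT)
  also have "\<dots> \<le> (spectral_norm ?Q * norm f)\<^sup>2 + (spectral_norm ?P * norm f)\<^sup>2"
    by (intro add_mono power_mono norm_mult_vec_le_spectral_norm) auto
  also have "\<dots> = (norm f * sqrt ((spectral_norm ?Q)\<^sup>2 + (spectral_norm ?P)\<^sup>2))\<^sup>2"
    by (simp add: power_mult_distrib algebra_simps)
  finally have le: "norm e \<le> norm f * sqrt ((spectral_norm ?Q)\<^sup>2 + (spectral_norm ?P)\<^sup>2)"
    by (rule power2_le_imp_le) simp
  have "norm f \<le> \<gamma> * sqrt (card D)"
    by (rule norm_le_sqrt_card[OF fD _ \<gamma>]) (metis f_le)
  then have "norm f * sqrt ((spectral_norm ?Q)\<^sup>2 + (spectral_norm ?P)\<^sup>2)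
      \<le> (\<gamma> * sqrt (card D)) * sqrt ((spectral_norm ?Q)\<^sup>2 + (spectral_norm ?P)\<^sup>2)"
    by (intro mult_right_mono) auto
  with le show ?thesis
    by (simp add: e_def)
qed

text \<open>Passing through \<open>c_min\<close> separates the bias caused by the penalty from the
  error caused by the noise.\<close>

lemma norm_diff_d_min_le:
  fixes A :: "real^'m^'n"
  assumes inv: "invertible_on (T \<union> D) (gram A (T \<union> D))" and disj: "T \<inter> D = {}"
    and \<gamma>: "\<gamma> \<ge> 0" and x: "subvec x (T \<union> D) = x" and y: "y = A *v x + w"
  shows "norm (x - d_min A y \<gamma> T D) \<le> \<gamma> * sqrt (card D) *
      sqrt ((spectral_norm (inv_on T (gram A T) ** transpose (subcols A T) **
               subcols A D ** P_mat A T D))\<^sup>2 + (spectral_norm (P_mat A T D))\<^sup>2)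
    + spectral_norm (inv_on (T \<union> D) (gram A (T \<union> D)) ** transpose (subcols A (T \<union> D))) * norm w"
proof -
  have "norm (x - d_min A y \<gamma> T D)
      \<le> norm (c_min A y T D - d_min A y \<gamma> T D) + norm (c_min A y T D - x)"
    using norm_triangle_ineq4[of "c_min A y T D - d_min A y \<gamma> T D" "c_min A y T D - x"] by simp
  also have "\<dots> \<le> norm (c_min A y T D - d_min A y \<gamma> T D) +
      spectral_norm (inv_on (T \<union> D) (gram A (T \<union> D)) ** transpose (subcols A (T \<union> D))) * norm w"
    unfolding c_min_error[OF inv x y] by (intro add_left_mono norm_mult_vec_le_spectral_norm)
  finally show ?thesis
    using norm_c_min_diff_d_min_le[OF inv disj \<gamma>, where y = y] by simp
qed

section \<open>Specialization to empty \<open>T\<close>, and the conclusion\<close>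

lemma bpdn_obj_eq_mod_bpdn_obj: "bpdn_obj A y \<gamma> = mod_bpdn_obj A y \<gamma> {}"
  by (simp add: fun_eq_iff bpdn_obj_def mod_bpdn_obj_def subvec_def)

lemma matrix_mult_transpose_subcols_empty: "B ** transpose (subcols A {}) = 0"
  by (simp add: vec_eq_iff matrix_matrix_mult_def subcols_def transpose_def)

lemma zero_matrix_mult: "0 ** B = 0"
  by (simp add: vec_eq_iff matrix_matrix_mult_def)

lemma M_proj_empty: "M_proj A {} = mat 1"
  by (simp add: M_proj_def matrix_mult_transpose_subcols_empty)

lemma P_mat_empty: "P_mat A {} D = inv_on D (gram A D)"
  by (simp add: P_mat_def M_proj_empty gram_def)

lemma ERC_empty: "ERC A {} D =
    1 - max0 ((\<lambda>\<omega>. norm_1 ((inv_on D (gram A D) ** transpose (subcols A D)) *v column \<omega> A)) ` (- D))"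
  by (simp add: ERC_def P_mat_empty M_proj_empty)

lemma spectral_norm_zero: "spectral_norm 0 = 0"
  by (simp add: spectral_norm_def onorm_zero)

theorem corollary1:
  fixes A :: "real^'m^'n" and x :: "real^'m" and w y :: "real^'n"
    and N T \<Delta> :: "'m set" and \<gamma> :: real
  assumes "CARD('n) < CARD('m)"
    and "N = {i. x $ i \<noteq> 0}"
    and "y = A *v x + w"
    and "\<Delta> = N - T"
    and "\<gamma> > 0"
  shows
    "(invertible_on (T \<union> \<Delta>) (gram A (T \<union> \<Delta>)) \<and>
      ERC A T \<Delta> > 0 \<and>
      \<gamma> \<ge> infnorm (transpose (subcols A (- (T \<union> \<Delta>))) *v (y - A *v c_min A y T \<Delta>)) / ERC A T \<Delta>
      \<longrightarrow>
      (\<exists>!b. is_arg_min (mod_bpdn_obj A y \<gamma> T) (\<lambda>_. True) b) \<and>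
      (\<forall>xh. is_arg_min (mod_bpdn_obj A y \<gamma> T) (\<lambda>_. True) xh \<longrightarrow>
         xh = d_min A y \<gamma> T \<Delta> \<and>
         supported_on xh (T \<union> \<Delta>) \<and>
         norm (x - xh) \<le>
           \<gamma> * sqrt (card \<Delta>) *
             sqrt ((spectral_norm (inv_on T (gram A T) ** transpose (subcols A T) **
                      subcols A \<Delta> ** P_mat A T \<Delta>))\<^sup>2 + (spectral_norm (P_mat A T \<Delta>))\<^sup>2)
           + spectral_norm (inv_on (T \<union> \<Delta>) (gram A (T \<union> \<Delta>)) **
                      transpose (subcols A (T \<union> \<Delta>))) * norm w))
     \<and>
     (invertible_on N (gram A N) \<longrightarrow>
      ERC A {} N =
        1 - max0 ((\<lambda>\<omega>. norm_1 ((inv_on N (gram A N) ** transpose (subcols A N)) *v column \<omega> A)) ` (- N)) \<and>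
      (ERC A {} N > 0 \<and>
       \<gamma> \<ge> infnorm (transpose (subcols A (- N)) *v (y - A *v c_min A y {} N)) / ERC A {} N
       \<longrightarrow>
       (\<exists>!b. is_arg_min (bpdn_obj A y \<gamma>) (\<lambda>_. True) b) \<and>
       (\<forall>xh. is_arg_min (bpdn_obj A y \<gamma>) (\<lambda>_. True) xh \<longrightarrow>
          xh = d_min A y \<gamma> {} N \<and>
          supported_on xh N \<and>
          norm (x - xh) \<le>
            \<gamma> * sqrt (card N) * spectral_norm (inv_on N (gram A N))
            + spectral_norm (inv_on N (gram A N) ** transpose (subcols A N)) * norm w)))"
proof -
  have disj: "T \<inter> \<Delta> = {}"
    using assms(4) by auto
  have x: "subvec x (T \<union> \<Delta>) = x" and xN: "subvec x ({} \<union> N) = x"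
    using assms(2,4) by (auto simp: subvec_eq_self_iff)
  have \<gamma>: "\<gamma> \<ge> 0"
    using assms(5) by simp
  note mod = d_min_unique_minimizer[OF _ disj _ assms(5), where A = A and y = y]
    d_min_minimizes(1)[OF _ \<gamma>, where T = T and D = \<Delta> and A = A and y = y]
    norm_diff_d_min_le[OF _ disj \<gamma> x assms(3)]
  note bpdn = d_min_unique_minimizer[OF _ Int_empty_left _ assms(5), where D = N and A = A and y = y]
    d_min_minimizes(1)[OF _ \<gamma>, where T = "{}" and D = N and A = A and y = y]
    norm_diff_d_min_le[OF _ Int_empty_left \<gamma> xN assms(3)]
  \<comment> \<open>In the second half the block for \<open>T = {}\<close> is the zero matrix, so
    the square root collapses to the spectral norm of \<open>P_mat\<close>, which is then the
    inverse Gram matrix.\<close>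
  show ?thesis
    unfolding supported_on_iff_subvec bpdn_obj_eq_mod_bpdn_obj
    using mod bpdn
    by (simp add: P_mat_empty matrix_mult_transpose_subcols_empty zero_matrix_mult
        spectral_norm_zero spectral_norm_nonneg flip: ERC_empty)
qed

end
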